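(* Consider the dynamics on $\mathbb{R}^{|S|}\times\mathbb{R}^{|S|\times|A|}_{>0}$ $$\frac{dv_{s'}}{dt}=-\Big(v_{s'}-\frac1\alpha\sum_{s,a}K_{ass'}u_{sa}\Big),\ s'\in S,\qquad \frac{du_{sa}}{dt}=-u_{sa}\Big(\log\frac{u_{sa}}{\tilde u_s}-\frac1\tau\Big(r_{sa}-\sum_{s'}K_{ass'}v_{s'}\Big)\Big),\ (s,a)\in S\times A.$$ This dynamics converges globally to $(v^*,u^* )$, the unique saddle point of $\min_v\max_u E(v,u)$; i.e. $(v^*,u^* )$ is globally asymptotically stable.
   Context: Finite MDP: state space $S$, action space $A$, transition probabilities $P_{ass'}$ (with $\sum_{s'}P_{ass'}=1$), rewards $r_{sa}\ge0$, discount $\gamma\in(0,1)$, regularization $\tau>0$, and $\alpha>0$. $K_{ass'}=\delta_{ss'}-\gamma P_{ass'}$, $\tilde u_s=\sum_a u_{sa}$, and $E(v,u)=\frac{\alpha}{2}\sum_s v_s^2+\sum_{s,a}u_{sa}(r_{sa}-\sum_{s'}K_{ass'}v_{s'})-\tau\sum_{s,a}u_{sa}\log(u_{sa}/\tilde u_s)$. This min-max problem has a unique saddle point $(v^*,u^* )$. *)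

theory Defs
  imports "HOL-Analysis.Analysis"
begin

text \<open>Finite MDP: states of finite type 's, actions of finite type 'a.
  Transition probabilities P a s s' (sum over s' equals 1).\<close>

definition Kmat :: "real \<Rightarrow> ('a \<Rightarrow> 's \<Rightarrow> 's \<Rightarrow> real) \<Rightarrow> 'a \<Rightarrow> 's \<Rightarrow> 's \<Rightarrow> real" where
  "Kmat \<gamma> P a s s' = (if s = s' then 1 else 0) - \<gamma> * P a s s'"

definition utilde :: "('s \<Rightarrow> 'a::finite \<Rightarrow> real) \<Rightarrow> 's \<Rightarrow> real" where
  "utilde u s = (\<Sum>a\<in>UNIV. u s a)"

definition Efun :: "real \<Rightarrow> real \<Rightarrow> real \<Rightarrow> ('a::finite \<Rightarrow> 's::finite \<Rightarrow> 's \<Rightarrow> real)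
    \<Rightarrow> ('s \<Rightarrow> 'a \<Rightarrow> real) \<Rightarrow> ('s \<Rightarrow> real) \<Rightarrow> ('s \<Rightarrow> 'a \<Rightarrow> real) \<Rightarrow> real" where
  "Efun \<alpha> \<tau> \<gamma> P r v u =
     \<alpha> / 2 * (\<Sum>s\<in>UNIV. (v s)\<^sup>2)
     + (\<Sum>s\<in>UNIV. \<Sum>a\<in>UNIV. u s a * (r s a - (\<Sum>s'\<in>UNIV. Kmat \<gamma> P a s s' * v s')))
     - \<tau> * (\<Sum>s\<in>UNIV. \<Sum>a\<in>UNIV. u s a * ln (u s a / utilde u s))"

definition is_saddle :: "real \<Rightarrow> real \<Rightarrow> real \<Rightarrow> ('a::finite \<Rightarrow> 's::finite \<Rightarrow> 's \<Rightarrow> real)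
    \<Rightarrow> ('s \<Rightarrow> 'a \<Rightarrow> real) \<Rightarrow> ('s \<Rightarrow> real) \<Rightarrow> ('s \<Rightarrow> 'a \<Rightarrow> real) \<Rightarrow> bool" where
  "is_saddle \<alpha> \<tau> \<gamma> P r vs us \<longleftrightarrow>
     (\<forall>s a. us s a > 0) \<and>
     (\<forall>u. (\<forall>s a. u s a > 0) \<longrightarrow> Efun \<alpha> \<tau> \<gamma> P r vs u \<le> Efun \<alpha> \<tau> \<gamma> P r vs us) \<and>
     (\<forall>v. Efun \<alpha> \<tau> \<gamma> P r vs us \<le> Efun \<alpha> \<tau> \<gamma> P r v us)"

definition is_solution :: "real \<Rightarrow> real \<Rightarrow> real \<Rightarrow> ('a::finite \<Rightarrow> 's::finite \<Rightarrow> 's \<Rightarrow> real)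
    \<Rightarrow> ('s \<Rightarrow> 'a \<Rightarrow> real) \<Rightarrow> (real \<Rightarrow> 's \<Rightarrow> real) \<Rightarrow> (real \<Rightarrow> 's \<Rightarrow> 'a \<Rightarrow> real) \<Rightarrow> bool" where
  "is_solution \<alpha> \<tau> \<gamma> P r v u \<longleftrightarrow>
     (\<forall>t\<ge>0. \<forall>s a. u t s a > 0) \<and>
     (\<forall>t\<ge>0. \<forall>s'. ((\<lambda>x. v x s') has_real_derivative
         (- (v t s' - (1 / \<alpha>) * (\<Sum>s\<in>UNIV. \<Sum>a\<in>UNIV. Kmat \<gamma> P a s s' * u t s a))))
         (at t within {0..})) \<and>
     (\<forall>t\<ge>0. \<forall>s a. ((\<lambda>x. u x s a) has_real_derivative
         (- u t s a * (ln (u t s a / utilde (u t) s)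
             - (1 / \<tau>) * (r s a - (\<Sum>s'\<in>UNIV. Kmat \<gamma> P a s s' * v t s')))))
         (at t within {0..}))"

text \<open>Distance on the finite-dimensional state space (l1; all norms are equivalent).\<close>
definition state_dist :: "('s::finite \<Rightarrow> real) \<Rightarrow> ('s \<Rightarrow> 'a::finite \<Rightarrow> real)
    \<Rightarrow> ('s \<Rightarrow> real) \<Rightarrow> ('s \<Rightarrow> 'a \<Rightarrow> real) \<Rightarrow> real" where
  "state_dist v u v' u' = (\<Sum>s\<in>UNIV. \<bar>v s - v' s\<bar>) + (\<Sum>s\<in>UNIV. \<Sum>a\<in>UNIV. \<bar>u s a - u' s a\<bar>)"

end

theory Submission
  imports Defs
begin

text \<open>
  Write \<open>\<pi> = u / utilde u\<close> for the policy of \<open>u\<close> and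
  \<open>D(c, y) = c ln (c / y) + y - c\<close>. Along solutions the Lyapunov function
  \<open>L = \<alpha>/2 |v - v*|\<^sup>2 + \<tau> \<Sum>\<^sub>s\<^sub>a D(u*\<^sub>s\<^sub>a, u\<^sub>s\<^sub>a)\<close> satisfies
  \<open>dL/dt \<le> - \<alpha> |v - v*|\<^sup>2 - \<tau> \<Sum>\<^sub>s utilde u*\<^sub>s \<Sum>\<^sub>a (\<surd>\<pi>*\<^sub>s\<^sub>a - \<surd>\<pi>\<^sub>s\<^sub>a)\<^sup>2\<close>:
  the cross terms cancel because \<open>\<alpha> v* = K\<^sup>T u*\<close> (stationarity in \<open>v\<close>), what remains is
  \<open>E(v*, u) - E(v*, u*) \<le> 0\<close> plus a Kullback-Leibler term, and KL dominates the squared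
  Hellinger distance. Small sublevel sets of \<open>L\<close> are small neighbourhoods of \<open>(v*, u*)\<close>, which
  gives stability; they also keep \<open>u\<close> bounded away from \<open>0\<close>, so the vector field is bounded
  along a solution and Barbalat's lemma yields \<open>v \<rightarrow> v*\<close> and \<open>\<pi> \<rightarrow> \<pi>*\<close>. Applied to
  \<open>v\<close> itself it gives \<open>dv/dt \<rightarrow> 0\<close>, i.e. \<open>K\<^sup>T u \<rightarrow> \<alpha> v* = K\<^sup>T u*\<close>. Finally
  \<open>K\<^sup>T u = (I - \<gamma> P\<^sub>\<pi>\<^sub>*)\<^sup>T utilde u + o(1)\<close>, and \<open>I - \<gamma> P\<^sub>\<pi>\<^sub>*\<close> is invertible for
  \<open>\<gamma> < 1\<close>, so \<open>utilde u \<rightarrow> utilde u*\<close> and hence \<open>u \<rightarrow> u*\<close>.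
\<close>

section \<open>Real functions on the half-line\<close>

lemma mvt_within:
  fixes f f' :: "real \<Rightarrow> real"
  assumes "a \<le> b" "{a..b} \<subseteq> S"
    and der: "\<And>x. x \<in> S \<Longrightarrow> (f has_real_derivative f' x) (at x within S)"
  obtains x where "x \<in> {a..b}" "f b - f a = f' x * (b - a)"
proof -
  have "\<exists>x\<in>{a..b}. f b - f a = f' x * (b - a)"
  proof (rule mvt_very_simple[OF \<open>a \<le> b\<close>])
    fix x assume "a \<le> x" "x \<le> b"
    then have "(f has_real_derivative f' x) (at x within {a..b})"
      using assms by (intro has_field_derivative_subset[OF der]) auto
    then show "(f has_derivative (\<lambda>h. f' x * h)) (at x within {a..b})"
      by (simp add: has_field_derivative_def)
  qed
  with that show ?thesis by blast
qed

lemma DERIV_nonpos_imp_decreasing_on_nonneg: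
  fixes f f' :: "real \<Rightarrow> real"
  assumes der: "\<And>t. t \<ge> 0 \<Longrightarrow> (f has_real_derivative f' t) (at t within {0..})"
    and nonpos: "\<And>t. t \<ge> 0 \<Longrightarrow> f' t \<le> 0" and "0 \<le> a" "a \<le> b"
  shows "f b \<le> f a"
proof -
  obtain x where "x \<in> {a..b}" "f b - f a = f' x * (b - a)"
    using mvt_within[of a b "{0..}" f f'] assms by auto
  moreover have "f' x * (b - a) \<le> 0"
    using nonpos calculation assms by (intro mult_nonpos_nonneg) auto
  ultimately show ?thesis by simp
qed

lemma bounded_DERIV_imp_lipschitz_on_nonneg:
  fixes f f' :: "real \<Rightarrow> real"
  assumes der: "\<And>t. t \<ge> 0 \<Longrightarrow> (f has_real_derivative f' t) (at t within {0..})"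
    and "bounded (f' ` {0..})"
  obtains B where "B-lipschitz_on {0..} f"
proof -
  obtain B where bound: "\<And>t. t \<ge> 0 \<Longrightarrow> \<bar>f' t\<bar> \<le> B"
    using assms(2) by (auto simp: bounded_iff)
  have "B-lipschitz_on {0..} f"
  proof (rule bounded_derivative_imp_lipschitz)
    fix t :: real assume "t \<in> {0..}"
    then show "(f has_derivative (\<lambda>h. f' t * h)) (at t within {0..})"
      using der by (simp add: has_field_derivative_def)
    have "(\<lambda>h. f' t * h) = (\<lambda>h. f' t *\<^sub>R h)"
      by (simp add: fun_eq_iff)
    then have "onorm (\<lambda>h. f' t * h) = \<bar>f' t\<bar>"
      using onorm_scaleR[OF bounded_linear_ident, of "f' t"] onorm_id by (metis mult.right_neutral)
    then show "onorm (\<lambda>h. f' t * h) \<le> B"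
      using bound \<open>t \<in> {0..}\<close> by simp
  qed (use bound[of 0] in auto)
  then show ?thesis ..
qed

lemma decreasing_bounded_below_convergent_at_top:
  fixes f :: "real \<Rightarrow> real"
  assumes dec: "\<And>a b. 0 \<le> a \<Longrightarrow> a \<le> b \<Longrightarrow> f b \<le> f a" and below: "\<And>t. t \<ge> 0 \<Longrightarrow> c \<le> f t"
  obtains l where "(f \<longlongrightarrow> l) at_top"
proof
  have bdd: "bdd_below (f ` {0..})"
    using below by (auto intro!: bdd_belowI[of _ c])
  show "(f \<longlongrightarrow> Inf (f ` {0..})) at_top"
  proof (rule decreasing_tendsto)
    show "\<forall>\<^sub>F t in at_top. Inf (f ` {0..}) \<le> f t"
      using eventually_ge_at_top[of 0] by eventually_elim (use bdd in \<open>auto intro: cInf_lower\<close>)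
  next
    fix x assume "Inf (f ` {0..}) < x"
    then obtain t0 where "t0 \<ge> 0" "f t0 < x"
      using cInf_less_iff[OF _ bdd] by auto
    then have "f t < x" if "t \<ge> t0" for t
      using dec[of t0 t] that by force
    then show "\<forall>\<^sub>F t in at_top. f t < x"
      by (intro eventually_mono[OF eventually_ge_at_top[of t0]])
  qed
qed

lemma barbalat_eventually_less:
  fixes F F' \<phi> :: "real \<Rightarrow> real"
  assumes conv: "(F \<longlongrightarrow> l) at_top"
    and der: "\<And>t. t \<ge> 0 \<Longrightarrow> (F has_real_derivative F' t) (at t within {0..})"
    and uc: "uniformly_continuous_on {0..} \<phi>"
    and le: "\<And>t. t \<ge> 0 \<Longrightarrow> \<phi> t \<le> F' t" and "e > 0"
  shows "\<forall>\<^sub>F t in at_top. \<phi> t < e"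
proof (rule ccontr)
  assume not_small: "\<not> (\<forall>\<^sub>F t in at_top. \<phi> t < e)"
  obtain d where "d > 0" and d: "\<And>x x'. x \<ge> 0 \<Longrightarrow> x' \<ge> 0 \<Longrightarrow> dist x' x < d \<Longrightarrow> dist (\<phi> x') (\<phi> x) < e/2"
    using uc \<open>e > 0\<close> unfolding uniformly_continuous_on_def by (metis atLeast_iff half_gt_zero)
  have "\<forall>\<^sub>F t in at_top. dist (F t) l < e * d / 8"
    using conv[unfolded tendsto_iff, rule_format, of "e * d / 8"] \<open>e > 0\<close> \<open>d > 0\<close> by simp
  then obtain T where T: "\<And>t. t \<ge> T \<Longrightarrow> dist (F t) l < e * d / 8"
    by (auto simp: eventually_at_top_linorder)
  from not_small obtain t where t: "t \<ge> max T 0" "\<phi> t \<ge> e"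
    unfolding eventually_at_top_linorder by (meson not_less)
  obtain x where x: "x \<in> {t..t + d/2}" "F (t + d/2) - F t = F' x * (d/2)"
    using mvt_within[of t "t + d/2" "{0..}" F F'] der t \<open>d > 0\<close> by auto
  have "dist (\<phi> x) (\<phi> t) < e/2"
    using d[of t x] x t \<open>d > 0\<close> by (auto simp: dist_real_def)
  moreover have "\<phi> x \<le> F' x"
    using le x t by auto
  ultimately have "F' x > e/2"
    using t unfolding dist_real_def by linarith
  then have "F (t + d/2) - F t > e/2 * (d/2)"
    unfolding x(2) using \<open>d > 0\<close> by (intro mult_strict_right_mono) auto
  moreover have "dist (F (t + d/2)) l < e * d / 8" "dist (F t) l < e * d / 8"
    using T t \<open>d > 0\<close> by auto
  ultimately show False
    unfolding dist_real_def by linarith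
qed

lemma barbalat_nonneg:
  fixes F F' \<phi> :: "real \<Rightarrow> real"
  assumes "(F \<longlongrightarrow> l) at_top"
    and "\<And>t. t \<ge> 0 \<Longrightarrow> (F has_real_derivative F' t) (at t within {0..})"
    and "uniformly_continuous_on {0..} \<phi>"
    and "\<And>t. t \<ge> 0 \<Longrightarrow> 0 \<le> \<phi> t" "\<And>t. t \<ge> 0 \<Longrightarrow> \<phi> t \<le> F' t"
  shows "(\<phi> \<longlongrightarrow> 0) at_top"
proof (rule order_tendstoI)
  fix e :: real assume "e < 0"
  show "\<forall>\<^sub>F t in at_top. e < \<phi> t"
    using eventually_ge_at_top[of 0] by eventually_elim (use assms(4) \<open>e < 0\<close> in force)
qed (rule barbalat_eventually_less[OF assms(1,2,3,5)])

lemma barbalat: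
  fixes F F' :: "real \<Rightarrow> real"
  assumes conv: "(F \<longlongrightarrow> l) at_top"
    and der: "\<And>t. t \<ge> 0 \<Longrightarrow> (F has_real_derivative F' t) (at t within {0..})"
    and uc: "uniformly_continuous_on {0..} F'"
  shows "(F' \<longlongrightarrow> 0) at_top"
proof (rule order_tendstoI)
  fix e :: real assume "e > 0"
  then show "\<forall>\<^sub>F t in at_top. F' t < e"
    using barbalat_eventually_less[OF conv der uc] by blast
next
  fix e :: real assume "e < 0"
  have "\<forall>\<^sub>F t in at_top. - F' t < - e"
    using \<open>e < 0\<close> by (intro barbalat_eventually_less[OF tendsto_minus[OF conv] _
          uniformly_continuous_on_minus[OF uc]]) (auto intro: DERIV_minus der)
  then show "\<forall>\<^sub>F t in at_top. e < F' t"
    by eventually_elim simp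
qed

lemma uniformly_continuous_on_compose_compact:
  fixes f :: "'a::metric_space \<Rightarrow> 'b::metric_space" and g :: "'b \<Rightarrow> 'c::metric_space"
  assumes "uniformly_continuous_on S f" "f ` S \<subseteq> C" "compact C" "continuous_on C g"
  shows "uniformly_continuous_on S (\<lambda>x. g (f x))"
proof (rule uniformly_continuous_on_compose[OF assms(1)])
  have "uniformly_continuous_on C g"
    using assms(4,3) by (rule compact_uniformly_continuous)
  then show "uniformly_continuous_on (f ` S) g"
    using assms(2) unfolding uniformly_continuous_on_def by (meson subsetD)
qed

lemma bounded_mult_comp:
  fixes f g :: "'a \<Rightarrow> real"
  assumes "bounded (f ` S)" "bounded (g ` S)"
  shows "bounded ((\<lambda>x. f x * g x) ` S)"
proof -
  obtain B C where "\<And>x. x \<in> S \<Longrightarrow> \<bar>f x\<bar> \<le> B" "\<And>x. x \<in> S \<Longrightarrow> \<bar>g x\<bar> \<le> C"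
    using assms by (auto simp: bounded_iff)
  then have "\<And>x. x \<in> S \<Longrightarrow> \<bar>f x * g x\<bar> \<le> B * C"
    unfolding abs_mult by (meson abs_ge_zero mult_mono order_trans)
  then show ?thesis
    by (auto simp: bounded_iff)
qed

lemma bounded_const_comp: "bounded ((\<lambda>x. c) ` S)"
  by (rule bounded_subset[of "{c}"]) auto

lemma bounded_sum_comp:
  fixes f :: "'i \<Rightarrow> 'a \<Rightarrow> 'b::real_normed_vector"
  assumes "finite I" "\<And>i. i \<in> I \<Longrightarrow> bounded (f i ` S)"
  shows "bounded ((\<lambda>x. \<Sum>i\<in>I. f i x) ` S)"
  using assms by (induction I rule: finite_induct) (auto intro: bounded_plus_comp bounded_const_comp)

lemma bounded_ln_comp:
  fixes f :: "'a \<Rightarrow> real"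
  assumes "bounded (f ` S)" "c > 0" "\<And>x. x \<in> S \<Longrightarrow> c \<le> f x"
  shows "bounded ((\<lambda>x. ln (f x)) ` S)"
proof -
  obtain B where "\<And>x. x \<in> S \<Longrightarrow> \<bar>f x\<bar> \<le> B"
    using assms(1) by (auto simp: bounded_iff)
  then have "\<And>x. x \<in> S \<Longrightarrow> \<bar>ln (f x)\<bar> \<le> \<bar>ln c\<bar> + \<bar>ln B\<bar>"
    using assms(2,3) by (smt (verit) ln_le_cancel_iff)
  then show ?thesis
    by (auto simp: bounded_iff)
qed

lemma tendsto_zero_of_square:
  fixes f :: "'b \<Rightarrow> real"
  assumes "((\<lambda>t. (f t)\<^sup>2) \<longlongrightarrow> 0) F"
  shows "(f \<longlongrightarrow> 0) F"
  using tendsto_real_sqrt[OF assms] by (simp add: tendsto_rabs_zero_iff)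

lemma bounded_mult_tendsto_zero:
  fixes f g :: "real \<Rightarrow> real"
  assumes "bounded (f ` {0..})" "(g \<longlongrightarrow> 0) at_top"
  shows "((\<lambda>t. f t * g t) \<longlongrightarrow> 0) at_top"
proof -
  obtain B where B: "\<And>t. t \<ge> 0 \<Longrightarrow> \<bar>f t\<bar> \<le> B"
    using assms(1) by (auto simp: bounded_iff)
  show ?thesis
  proof (rule tendsto_0_le[OF assms(2), of _ B])
    show "\<forall>\<^sub>F t in at_top. norm (f t * g t) \<le> norm (g t) * B"
      using eventually_ge_at_top[of 0]
      by eventually_elim (use B in \<open>auto simp: abs_mult mult.commute intro: mult_right_mono\<close>)
  qed
qed

section \<open>Divergences and stochastic matrices\<close>

definition kl_div :: "real \<Rightarrow> real \<Rightarrow> real" where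
  "kl_div c y = c * (ln c - ln y) + y - c"

lemma sqrt_diff_squared_le_kl_div:
  assumes "c > 0" "y > 0"
  shows "(sqrt y - sqrt c)\<^sup>2 \<le> kl_div c y"
proof -
  define z where "z = sqrt y / sqrt c"
  have "z > 0" using assms by (simp add: z_def)
  have "ln y - ln c = 2 * ln z"
    using assms \<open>z > 0\<close> by (simp add: z_def ln_div ln_sqrt)
  then have "c * (ln c - ln y) \<ge> c * (- 2 * (z - 1))"
    using ln_le_minus_one[OF \<open>z > 0\<close>] assms by (intro mult_left_mono) auto
  moreover have "c * z = sqrt c * sqrt y"
    using assms by (simp add: z_def field_simps)
  moreover have "(sqrt y - sqrt c)\<^sup>2 = y + c - 2 * sqrt c * sqrt y"
    using assms by (simp add: power2_diff)
  ultimately show ?thesis unfolding kl_div_def by (simp add: algebra_simps)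
qed

lemma kl_div_nonneg: "c > 0 \<Longrightarrow> y > 0 \<Longrightarrow> kl_div c y \<ge> 0"
  using sqrt_diff_squared_le_kl_div[of c y] by (meson order_trans zero_le_power2)

lemma kl_div_le_chi_squared:
  assumes "c > 0" "y > 0"
  shows "kl_div c y \<le> (y - c)\<^sup>2 / y"
proof -
  have "ln c - ln y \<le> c / y - 1"
    using ln_le_minus_one[of "c / y"] assms by (simp add: ln_div)
  then have "c * (ln c - ln y) \<le> c * (c / y - 1)"
    using assms by (simp add: mult_left_mono)
  moreover have "c * (c / y - 1) + y - c = (y - c)\<^sup>2 / y"
    using assms by (simp add: field_simps power2_eq_square)
  ultimately show ?thesis unfolding kl_div_def by linarith
qed

lemma kl_div_bounded_imp_lower_bound:
  assumes "c > 0" "y > 0" "kl_div c y \<le> B"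
  shows "c * exp (- ((B + c) / c)) \<le> y"
proof -
  have "c * (ln c - ln y) \<le> B + c"
    using assms unfolding kl_div_def by linarith
  then have "ln c - (B + c) / c \<le> ln y"
    using assms by (simp add: field_simps)
  then have "exp (ln c - (B + c) / c) \<le> y"
    using assms by (metis exp_le_cancel_iff exp_ln)
  moreover have "exp (ln c - (B + c) / c) = c * exp (- ((B + c) / c))"
    using assms by (simp add: exp_diff exp_minus divide_inverse)
  ultimately show ?thesis
    by simp
qed

lemma kl_div_bounded_imp_near:
  assumes "c > 0" "y > 0" "kl_div c y \<le> B"
  shows "\<bar>y - c\<bar> \<le> sqrt B * (2 * sqrt c + sqrt B)"
proof -
  have sq: "(sqrt y - sqrt c)\<^sup>2 \<le> B"
    using sqrt_diff_squared_le_kl_div assms by (meson order_trans)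
  then have "B \<ge> 0"
    by (meson order_trans zero_le_power2)
  have close: "\<bar>sqrt y - sqrt c\<bar> \<le> sqrt B"
    using sq by (metis real_sqrt_abs real_sqrt_le_mono)
  have "y - c = (sqrt y - sqrt c) * (sqrt y + sqrt c)"
    using assms by (simp add: algebra_simps)
  then have "\<bar>y - c\<bar> = \<bar>sqrt y - sqrt c\<bar> * (sqrt y + sqrt c)"
    using assms by (simp add: abs_mult)
  also have "\<dots> \<le> sqrt B * (2 * sqrt c + sqrt B)"
    using close \<open>B \<ge> 0\<close> assms by (intro mult_mono) (auto simp: abs_le_iff)
  finally show ?thesis .
qed

lemma kl_div_has_real_derivative:
  assumes "(f has_real_derivative f') (at t within S)" "f t > 0"
  shows "((\<lambda>x. kl_div c (f x)) has_real_derivative (1 - c / f t) * f') (at t within S)"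
proof -
  have "((\<lambda>x. ln (f x)) has_real_derivative 1 / f t * f') (at t within S)"
    by (rule DERIV_chain2[OF DERIV_ln_divide[OF assms(2)] assms(1)])
  then have "((\<lambda>x. c * (ln c - ln (f x)) + f x - c) has_real_derivative c * (0 - 1 / f t * f') + f' - 0)
      (at t within S)"
    by (intro DERIV_diff DERIV_add DERIV_cmult DERIV_const assms(1))
  then show ?thesis
    unfolding kl_div_def by (simp add: algebra_simps)
qed

lemma hellinger_le_kl:
  fixes p q :: "'a::finite \<Rightarrow> real"
  assumes "\<And>a. p a > 0" "\<And>a. q a > 0" "(\<Sum>a\<in>UNIV. p a) = 1" "(\<Sum>a\<in>UNIV. q a) = 1"
  shows "(\<Sum>a\<in>UNIV. (sqrt (p a) - sqrt (q a))\<^sup>2) \<le> (\<Sum>a\<in>UNIV. p a * (ln (p a) - ln (q a)))"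
proof -
  have "(\<Sum>a\<in>UNIV. (sqrt (p a) - sqrt (q a))\<^sup>2) \<le> (\<Sum>a\<in>UNIV. kl_div (p a) (q a))"
    using sqrt_diff_squared_le_kl_div assms by (intro sum_mono) (simp add: power2_commute)
  also have "\<dots> = (\<Sum>a\<in>UNIV. p a * (ln (p a) - ln (q a))) + (\<Sum>a\<in>UNIV. q a) - (\<Sum>a\<in>UNIV. p a)"
    by (simp add: kl_div_def sum.distrib sum_subtractf)
  finally show ?thesis
    using assms by simp
qed

lemma l1_bound_I_minus_stochastic:
  fixes Q :: "'s::finite \<Rightarrow> 's \<Rightarrow> real" and e :: "'s \<Rightarrow> real"
  assumes Q_nonneg: "\<And>s s'. 0 \<le> Q s s'" and Q_sum: "\<And>s. (\<Sum>s'\<in>UNIV. Q s s') = 1" and "0 \<le> \<gamma>"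
  shows "(1 - \<gamma>) * (\<Sum>s\<in>UNIV. \<bar>e s\<bar>) \<le> (\<Sum>s'\<in>UNIV. \<bar>e s' - \<gamma> * (\<Sum>s\<in>UNIV. e s * Q s s')\<bar>)"
proof -
  have "\<bar>e s'\<bar> \<le> \<bar>e s' - \<gamma> * (\<Sum>s\<in>UNIV. e s * Q s s')\<bar> + \<gamma> * (\<Sum>s\<in>UNIV. \<bar>e s\<bar> * Q s s')" for s'
  proof -
    have "\<bar>\<Sum>s\<in>UNIV. e s * Q s s'\<bar> \<le> (\<Sum>s\<in>UNIV. \<bar>e s\<bar> * Q s s')"
      using sum_abs[of "\<lambda>s. e s * Q s s'" UNIV] Q_nonneg by (simp add: abs_mult)
    then have "\<bar>\<gamma> * (\<Sum>s\<in>UNIV. e s * Q s s')\<bar> \<le> \<gamma> * (\<Sum>s\<in>UNIV. \<bar>e s\<bar> * Q s s')"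
      using \<open>0 \<le> \<gamma>\<close> by (simp add: abs_mult mult_left_mono)
    then show ?thesis by linarith
  qed
  then have "(\<Sum>s'\<in>UNIV. \<bar>e s'\<bar>)
      \<le> (\<Sum>s'\<in>UNIV. \<bar>e s' - \<gamma> * (\<Sum>s\<in>UNIV. e s * Q s s')\<bar> + \<gamma> * (\<Sum>s\<in>UNIV. \<bar>e s\<bar> * Q s s'))"
    by (rule sum_mono)
  also have "\<dots> = (\<Sum>s'\<in>UNIV. \<bar>e s' - \<gamma> * (\<Sum>s\<in>UNIV. e s * Q s s')\<bar>)
      + \<gamma> * (\<Sum>s'\<in>UNIV. \<Sum>s\<in>UNIV. \<bar>e s\<bar> * Q s s')"
    by (simp add: sum.distrib sum_distrib_left)
  also have "(\<Sum>s'\<in>UNIV. \<Sum>s\<in>UNIV. \<bar>e s\<bar> * Q s s') = (\<Sum>s\<in>UNIV. \<bar>e s\<bar>)"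
    by (subst sum.swap) (simp add: sum_distrib_left[symmetric] Q_sum)
  finally show ?thesis
    by (simp add: algebra_simps)
qed

lemma tendsto_zero_I_minus_stochastic:
  fixes Q :: "'s::finite \<Rightarrow> 's \<Rightarrow> real" and e :: "'b \<Rightarrow> 's \<Rightarrow> real"
  assumes "\<And>s s'. 0 \<le> Q s s'" "\<And>s. (\<Sum>s'\<in>UNIV. Q s s') = 1" "0 \<le> \<gamma>" "\<gamma> < 1"
    and lim: "\<And>s'. ((\<lambda>t. e t s' - \<gamma> * (\<Sum>s\<in>UNIV. e t s * Q s s')) \<longlongrightarrow> 0) F"
  shows "((\<lambda>t. e t s) \<longlongrightarrow> 0) F"
proof (rule tendsto_0_le)
  have "((\<lambda>t. \<bar>e t s' - \<gamma> * (\<Sum>s\<in>UNIV. e t s * Q s s')\<bar>) \<longlongrightarrow> 0) F" for s'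
    using tendsto_rabs_zero[OF lim] by simp
  then show "((\<lambda>t. \<Sum>s'\<in>UNIV. \<bar>e t s' - \<gamma> * (\<Sum>s\<in>UNIV. e t s * Q s s')\<bar>) \<longlongrightarrow> 0) F"
    using tendsto_sum[of UNIV "\<lambda>s' t. \<bar>e t s' - \<gamma> * (\<Sum>s\<in>UNIV. e t s * Q s s')\<bar>" "\<lambda>_. 0" F] by simp
  show "\<forall>\<^sub>F t in F. norm (e t s)
      \<le> norm (\<Sum>s'\<in>UNIV. \<bar>e t s' - \<gamma> * (\<Sum>s\<in>UNIV. e t s * Q s s')\<bar>) * (1 / (1 - \<gamma>))"
  proof (intro always_eventually allI)
    fix t
    have "(1 - \<gamma>) * \<bar>e t s\<bar> \<le> (1 - \<gamma>) * (\<Sum>s\<in>UNIV. \<bar>e t s\<bar>)"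
      using \<open>\<gamma> < 1\<close> by (intro mult_left_mono member_le_sum) auto
    also have "\<dots> \<le> (\<Sum>s'\<in>UNIV. \<bar>e t s' - \<gamma> * (\<Sum>s\<in>UNIV. e t s * Q s s')\<bar>)"
      using l1_bound_I_minus_stochastic assms(1-3) by blast
    finally show "norm (e t s)
        \<le> norm (\<Sum>s'\<in>UNIV. \<bar>e t s' - \<gamma> * (\<Sum>s\<in>UNIV. e t s * Q s s')\<bar>) * (1 / (1 - \<gamma>))"
      using \<open>\<gamma> < 1\<close> by (simp add: field_simps)
  qed
qed

section \<open>The saddle point\<close>

definition policy :: "('s \<Rightarrow> 'a::finite \<Rightarrow> real) \<Rightarrow> 's \<Rightarrow> 'a \<Rightarrow> real" where
  "policy y s a = y s a / utilde y s"

lemma utilde_pos: "(\<And>s a. y s a > 0) \<Longrightarrow> utilde y s > 0"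
  unfolding utilde_def by (intro sum_pos) auto

lemma policy_pos: "(\<And>s a. y s a > 0) \<Longrightarrow> policy y s a > 0"
  using utilde_pos[of y s] by (simp add: policy_def)

lemma policy_sum: "(\<And>s a. y s a > 0) \<Longrightarrow> (\<Sum>a\<in>UNIV. policy y s a) = 1"
  using utilde_pos[of y s] by (simp add: policy_def utilde_def sum_divide_distrib[symmetric])

lemma utilde_mult_policy: "(\<And>s a. y s a > 0) \<Longrightarrow> utilde y s * policy y s a = y s a"
  using utilde_pos[of y s] by (simp add: policy_def)

locale saddle_mdp =
  fixes P :: "'a::finite \<Rightarrow> 's::finite \<Rightarrow> 's \<Rightarrow> real"
    and r :: "'s \<Rightarrow> 'a \<Rightarrow> real"
    and \<gamma> \<tau> \<alpha> :: real
    and vs :: "'s \<Rightarrow> real" and us :: "'s \<Rightarrow> 'a \<Rightarrow> real"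
  assumes P_nonneg: "\<And>a s s'. P a s s' \<ge> 0"
    and P_sum: "\<And>a s. (\<Sum>s'\<in>UNIV. P a s s') = 1"
    and gamma: "0 < \<gamma>" "\<gamma> < 1"
    and tau: "0 < \<tau>"
    and alpha: "0 < \<alpha>"
    and saddle: "is_saddle \<alpha> \<tau> \<gamma> P r vs us"
begin

definition KT :: "('s \<Rightarrow> 'a \<Rightarrow> real) \<Rightarrow> 's \<Rightarrow> real" where
  "KT y s' = (\<Sum>s\<in>UNIV. \<Sum>a\<in>UNIV. Kmat \<gamma> P a s s' * y s a)"

definition advantage :: "('s \<Rightarrow> real) \<Rightarrow> 's \<Rightarrow> 'a \<Rightarrow> real" where
  "advantage x s a = r s a - (\<Sum>s'\<in>UNIV. Kmat \<gamma> P a s s' * x s')"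

definition vfield_v :: "('s \<Rightarrow> real) \<Rightarrow> ('s \<Rightarrow> 'a \<Rightarrow> real) \<Rightarrow> 's \<Rightarrow> real" where
  "vfield_v x y s' = - (x s' - (1 / \<alpha>) * (\<Sum>s\<in>UNIV. \<Sum>a\<in>UNIV. Kmat \<gamma> P a s s' * y s a))"

definition vfield_u :: "('s \<Rightarrow> real) \<Rightarrow> ('s \<Rightarrow> 'a \<Rightarrow> real) \<Rightarrow> 's \<Rightarrow> 'a \<Rightarrow> real" where
  "vfield_u x y s a = - y s a * (ln (y s a / utilde y s)
     - (1 / \<tau>) * (r s a - (\<Sum>s'\<in>UNIV. Kmat \<gamma> P a s s' * x s')))"

definition lyapunov :: "('s \<Rightarrow> real) \<Rightarrow> ('s \<Rightarrow> 'a \<Rightarrow> real) \<Rightarrow> real" where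
  "lyapunov x y = \<alpha> / 2 * (\<Sum>s\<in>UNIV. (x s - vs s)\<^sup>2) + \<tau> * (\<Sum>s\<in>UNIV. \<Sum>a\<in>UNIV. kl_div (us s a) (y s a))"

definition lyapunov_deriv :: "('s \<Rightarrow> real) \<Rightarrow> ('s \<Rightarrow> 'a \<Rightarrow> real) \<Rightarrow> real" where
  "lyapunov_deriv x y = \<alpha> * (\<Sum>s\<in>UNIV. (x s - vs s) * vfield_v x y s)
     + \<tau> * (\<Sum>s\<in>UNIV. \<Sum>a\<in>UNIV. (1 - us s a / y s a) * vfield_u x y s a)"

definition hellinger :: "('s \<Rightarrow> 'a \<Rightarrow> real) \<Rightarrow> real" where
  "hellinger y = (\<Sum>s\<in>UNIV. utilde us s * (\<Sum>a\<in>UNIV. (sqrt (policy us s a) - sqrt (policy y s a))\<^sup>2))"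

lemma us_pos: "us s a > 0"
  using saddle by (auto simp: is_saddle_def)

lemma utilde_us_pos: "utilde us s > 0"
  by (rule utilde_pos[OF us_pos])

lemma sum_mult_Kmat_eq_KT:
  "(\<Sum>s\<in>UNIV. \<Sum>a\<in>UNIV. y s a * (\<Sum>s'\<in>UNIV. Kmat \<gamma> P a s s' * x s')) = (\<Sum>s'\<in>UNIV. KT y s' * x s')"
proof -
  have "(\<Sum>s\<in>UNIV. \<Sum>a\<in>UNIV. y s a * (\<Sum>s'\<in>UNIV. Kmat \<gamma> P a s s' * x s'))
      = (\<Sum>s\<in>UNIV. \<Sum>a\<in>UNIV. \<Sum>s'\<in>UNIV. Kmat \<gamma> P a s s' * y s a * x s')"
    by (simp add: sum_distrib_left mult_ac)
  also have "\<dots> = (\<Sum>s\<in>UNIV. \<Sum>s'\<in>UNIV. \<Sum>a\<in>UNIV. Kmat \<gamma> P a s s' * y s a * x s')"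
    by (rule sum.cong[OF refl], rule sum.swap)
  also have "\<dots> = (\<Sum>s'\<in>UNIV. \<Sum>s\<in>UNIV. \<Sum>a\<in>UNIV. Kmat \<gamma> P a s s' * y s a * x s')"
    by (rule sum.swap)
  also have "\<dots> = (\<Sum>s'\<in>UNIV. KT y s' * x s')"
    by (simp add: KT_def sum_distrib_right)
  finally show ?thesis .
qed

lemma KT_diff: "KT (\<lambda>s a. y s a - z s a) s' = KT y s' - KT z s'"
  by (simp add: KT_def right_diff_distrib sum_subtractf)

lemma Efun_eq:
  "Efun \<alpha> \<tau> \<gamma> P r x y = \<alpha> / 2 * (\<Sum>s\<in>UNIV. (x s)\<^sup>2) + (\<Sum>s\<in>UNIV. \<Sum>a\<in>UNIV. y s a * r s a)
     - (\<Sum>s'\<in>UNIV. KT y s' * x s') - \<tau> * (\<Sum>s\<in>UNIV. \<Sum>a\<in>UNIV. y s a * ln (policy y s a))"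
  unfolding Efun_def policy_def sum_mult_Kmat_eq_KT[symmetric]
  by (simp add: right_diff_distrib sum_subtractf)

text \<open>\<open>v*\<close> minimises \<open>E(-, u*)\<close>; moving it by \<open>c / \<alpha>\<close> in coordinate \<open>s'\<close>, where \<open>c\<close> is the
  defect \<open>KT u* s' - \<alpha> v* s'\<close>, would lower \<open>E\<close> by \<open>c\<^sup>2 / (2 \<alpha>)\<close>.\<close>
lemma alpha_vs_eq_KT: "\<alpha> * vs s' = KT us s'"
proof -
  define c where "c = KT us s' - \<alpha> * vs s'"
  define h where "h = c / \<alpha>"
  define x where "x = (\<lambda>s. vs s + (if s = s' then h else 0))"
  have "(\<Sum>s\<in>UNIV. (x s)\<^sup>2) = (\<Sum>s\<in>UNIV. (vs s)\<^sup>2 + (if s = s' then 2 * h * vs s' + h\<^sup>2 else 0))"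
    by (rule sum.cong) (auto simp: x_def power2_eq_square algebra_simps)
  moreover have "(\<Sum>s\<in>UNIV. KT us s * x s) = (\<Sum>s\<in>UNIV. KT us s * vs s + (if s = s' then KT us s' * h else 0))"
    by (rule sum.cong) (auto simp: x_def algebra_simps)
  moreover have "Efun \<alpha> \<tau> \<gamma> P r vs us \<le> Efun \<alpha> \<tau> \<gamma> P r x us"
    using saddle by (auto simp: is_saddle_def)
  ultimately have "0 \<le> \<alpha> / 2 * (2 * h * vs s' + h\<^sup>2) - KT us s' * h"
    unfolding Efun_eq by (simp add: sum.distrib algebra_simps)
  also have "\<dots> = - c\<^sup>2 / (2 * \<alpha>)"
    using alpha by (simp add: h_def c_def field_simps power2_eq_square)
  finally have "c = 0"
    using alpha by (simp add: divide_le_0_iff)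
  then show ?thesis by (simp add: c_def)
qed

lemma Efun_vs_eq:
  "Efun \<alpha> \<tau> \<gamma> P r vs y = \<alpha> / 2 * (\<Sum>s\<in>UNIV. (vs s)\<^sup>2)
     + (\<Sum>s\<in>UNIV. \<Sum>a\<in>UNIV. y s a * (advantage vs s a - \<tau> * ln (policy y s a)))"
  unfolding Efun_def advantage_def policy_def
  by (simp add: right_diff_distrib sum_subtractf sum_distrib_left mult.left_commute)

lemma us_maximizes_Efun:
  assumes "\<And>s a. y s a > 0"
  shows "(\<Sum>s\<in>UNIV. \<Sum>a\<in>UNIV. y s a * (advantage vs s a - \<tau> * ln (policy y s a)))
    \<le> (\<Sum>s\<in>UNIV. \<Sum>a\<in>UNIV. us s a * (advantage vs s a - \<tau> * ln (policy us s a)))"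
  using saddle assms unfolding is_saddle_def Efun_vs_eq by auto

lemma hellinger_le_cross_entropy:
  assumes "\<And>s a. y s a > 0"
  shows "hellinger y \<le> (\<Sum>s\<in>UNIV. \<Sum>a\<in>UNIV. us s a * (ln (policy us s a) - ln (policy y s a)))"
  unfolding hellinger_def
proof (rule sum_mono)
  fix s
  have "(\<Sum>a\<in>UNIV. (sqrt (policy us s a) - sqrt (policy y s a))\<^sup>2)
      \<le> (\<Sum>a\<in>UNIV. policy us s a * (ln (policy us s a) - ln (policy y s a)))"
    using assms us_pos by (intro hellinger_le_kl policy_pos policy_sum)
  then have "utilde us s * (\<Sum>a\<in>UNIV. (sqrt (policy us s a) - sqrt (policy y s a))\<^sup>2)
      \<le> utilde us s * (\<Sum>a\<in>UNIV. policy us s a * (ln (policy us s a) - ln (policy y s a)))"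
    using utilde_us_pos[of s] by (intro mult_left_mono) auto
  also have "\<dots> = (\<Sum>a\<in>UNIV. us s a * (ln (policy us s a) - ln (policy y s a)))"
    by (simp add: sum_distrib_left mult.assoc[symmetric] utilde_mult_policy us_pos)
  finally show "utilde us s * (\<Sum>a\<in>UNIV. (sqrt (policy us s a) - sqrt (policy y s a))\<^sup>2)
      \<le> (\<Sum>a\<in>UNIV. us s a * (ln (policy us s a) - ln (policy y s a)))" .
qed

lemma v_part_lyapunov_deriv:
  "\<alpha> * (\<Sum>s\<in>UNIV. (x s - vs s) * vfield_v x y s)
     = (\<Sum>s\<in>UNIV. (x s - vs s) * (KT y s - KT us s)) - \<alpha> * (\<Sum>s\<in>UNIV. (x s - vs s)\<^sup>2)"
proof -
  have "\<alpha> * ((x s - vs s) * vfield_v x y s) = (x s - vs s) * (KT y s - KT us s) - \<alpha> * (x s - vs s)\<^sup>2" for s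
    using alpha alpha_vs_eq_KT[of s, symmetric]
    by (simp add: vfield_v_def KT_def field_simps power2_eq_square)
  then show ?thesis
    by (simp add: sum_distrib_left sum_subtractf)
qed

lemma u_part_lyapunov_deriv:
  assumes "\<And>s a. y s a > 0"
  shows "\<tau> * (\<Sum>s\<in>UNIV. \<Sum>a\<in>UNIV. (1 - us s a / y s a) * vfield_u x y s a)
    = (\<Sum>s\<in>UNIV. \<Sum>a\<in>UNIV. (y s a - us s a) * (advantage x s a - \<tau> * ln (policy y s a)))"
proof -
  have "\<tau> * ((1 - us s a / y s a) * vfield_u x y s a)
      = (y s a - us s a) * (advantage x s a - \<tau> * ln (policy y s a))" for s a
    using tau assms[of s a]
    by (simp add: vfield_u_def advantage_def policy_def field_simps)
  then show ?thesis
    by (simp add: sum_distrib_left)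
qed

lemma advantage_shift:
  "(\<Sum>s\<in>UNIV. \<Sum>a\<in>UNIV. (y s a - us s a) * (advantage x s a - \<tau> * ln (policy y s a)))
     = (\<Sum>s\<in>UNIV. \<Sum>a\<in>UNIV. (y s a - us s a) * (advantage vs s a - \<tau> * ln (policy y s a)))
       - (\<Sum>s\<in>UNIV. (x s - vs s) * (KT y s - KT us s))"
proof -
  have "(y s a - us s a) * (advantage x s a - \<tau> * ln (policy y s a))
      = (y s a - us s a) * (advantage vs s a - \<tau> * ln (policy y s a))
        - (y s a - us s a) * (\<Sum>s'\<in>UNIV. Kmat \<gamma> P a s s' * (x s' - vs s'))" for s a
    by (simp add: advantage_def right_diff_distrib sum_subtractf)
  moreover have "(\<Sum>s\<in>UNIV. \<Sum>a\<in>UNIV. (y s a - us s a) * (\<Sum>s'\<in>UNIV. Kmat \<gamma> P a s s' * (x s' - vs s')))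
      = (\<Sum>s\<in>UNIV. (x s - vs s) * (KT y s - KT us s))"
    unfolding sum_mult_Kmat_eq_KT KT_diff by (simp add: mult.commute)
  ultimately show ?thesis
    by (simp add: sum_subtractf)
qed

lemma lyapunov_deriv_le:
  assumes y: "\<And>s a. y s a > 0"
  shows "lyapunov_deriv x y \<le> - \<alpha> * (\<Sum>s\<in>UNIV. (x s - vs s)\<^sup>2) - \<tau> * hellinger y"
proof -
  let ?gain = "\<lambda>z p. \<Sum>s\<in>UNIV. \<Sum>a\<in>UNIV. z s a * (advantage vs s a - \<tau> * ln (policy p s a))"
  have "lyapunov_deriv x y = ?gain y y - ?gain us y - \<alpha> * (\<Sum>s\<in>UNIV. (x s - vs s)\<^sup>2)"
    unfolding lyapunov_deriv_def v_part_lyapunov_deriv u_part_lyapunov_deriv[OF y] advantage_shift[of y x]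
    by (simp add: left_diff_distrib sum_subtractf)
  moreover have "?gain y y \<le> ?gain us us"
    by (rule us_maximizes_Efun[OF y])
  moreover have "?gain us us - ?gain us y
      = - \<tau> * (\<Sum>s\<in>UNIV. \<Sum>a\<in>UNIV. us s a * (ln (policy us s a) - ln (policy y s a)))"
    unfolding sum_subtractf[symmetric] sum_distrib_left
    by (intro sum.cong refl) (simp add: algebra_simps)
  moreover have "- \<tau> * (\<Sum>s\<in>UNIV. \<Sum>a\<in>UNIV. us s a * (ln (policy us s a) - ln (policy y s a)))
      \<le> - \<tau> * hellinger y"
    using hellinger_le_cross_entropy[OF y] tau by simp
  ultimately show ?thesis by linarith
qed

lemma hellinger_nonneg: "hellinger y \<ge> 0"
  unfolding hellinger_def using utilde_us_pos by (intro sum_nonneg mult_nonneg_nonneg) (auto simp: less_imp_le)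

lemma lyapunov_nonneg: "(\<And>s a. y s a > 0) \<Longrightarrow> 0 \<le> lyapunov x y"
  unfolding lyapunov_def using alpha tau us_pos
  by (intro add_nonneg_nonneg mult_nonneg_nonneg sum_nonneg kl_div_nonneg) auto

lemma lyapunov_ge_v: "(\<And>s a. y s a > 0) \<Longrightarrow> \<alpha> / 2 * (x s - vs s)\<^sup>2 \<le> lyapunov x y"
  unfolding lyapunov_def using alpha tau us_pos
  by (intro add_increasing2 mult_nonneg_nonneg sum_nonneg kl_div_nonneg mult_left_mono member_le_sum) auto

lemma lyapunov_ge_kl_div: "(\<And>s a. y s a > 0) \<Longrightarrow> \<tau> * kl_div (us s a) (y s a) \<le> lyapunov x y"
proof -
  assume y: "\<And>s a. y s a > 0"
  have "kl_div (us s a) (y s a) \<le> (\<Sum>s\<in>UNIV. \<Sum>a\<in>UNIV. kl_div (us s a) (y s a))"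
    using y us_pos
    by (intro order_trans[OF _ member_le_sum[of s]] member_le_sum sum_nonneg kl_div_nonneg) auto
  then show ?thesis
    unfolding lyapunov_def using alpha tau
    by (intro add_increasing mult_nonneg_nonneg sum_nonneg mult_left_mono) auto
qed

lemma policy_us_pos: "policy us s a > 0"
  by (rule policy_pos[OF us_pos])

lemma policy_us_sum: "(\<Sum>a\<in>UNIV. policy us s a) = 1"
  by (rule policy_sum[OF us_pos])

lemma hellinger_ge:
  "utilde us s * (sqrt (policy us s a) - sqrt (policy y s a))\<^sup>2 \<le> hellinger y"
proof -
  have "utilde us s * (sqrt (policy us s a) - sqrt (policy y s a))\<^sup>2
      \<le> utilde us s * (\<Sum>a\<in>UNIV. (sqrt (policy us s a) - sqrt (policy y s a))\<^sup>2)"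
    using utilde_us_pos[of s] by (intro mult_left_mono member_le_sum) auto
  also have "\<dots> \<le> hellinger y"
    unfolding hellinger_def using utilde_us_pos
    by (intro member_le_sum[of s]) (auto intro!: mult_nonneg_nonneg sum_nonneg simp: less_imp_le)
  finally show ?thesis .
qed

definition Pstar :: "'s \<Rightarrow> 's \<Rightarrow> real" where
  "Pstar s s' = (\<Sum>a\<in>UNIV. policy us s a * P a s s')"

lemma Pstar_nonneg: "Pstar s s' \<ge> 0"
  unfolding Pstar_def using policy_us_pos P_nonneg
  by (intro sum_nonneg mult_nonneg_nonneg) (auto simp: less_imp_le)

lemma Pstar_sum: "(\<Sum>s'\<in>UNIV. Pstar s s') = 1"
  unfolding Pstar_def
  by (subst sum.swap) (simp add: sum_distrib_left[symmetric] P_sum policy_us_sum)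

lemma sum_policy_us_Kmat: "(\<Sum>a\<in>UNIV. policy us s a * Kmat \<gamma> P a s s') = (if s = s' then 1 else 0) - \<gamma> * Pstar s s'"
  by (simp add: Kmat_def Pstar_def right_diff_distrib sum_subtractf sum_distrib_left mult.left_commute
      policy_us_sum sum_distrib_right[symmetric])

lemma KT_eq_sum_policy:
  assumes "\<And>s a. y s a > 0"
  shows "KT y s' = (\<Sum>s\<in>UNIV. utilde y s * (\<Sum>a\<in>UNIV. policy y s a * Kmat \<gamma> P a s s'))"
  unfolding KT_def sum_distrib_left
proof (intro sum.cong refl)
  fix s a
  show "Kmat \<gamma> P a s s' * y s a = utilde y s * (policy y s a * Kmat \<gamma> P a s s')"
    using utilde_mult_policy[of y s a, OF assms] by (metis mult.assoc mult.commute)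
qed

text \<open>Given the policies, the state weights \<open>utilde y\<close> are recovered from \<open>KT y\<close> through the
  invertible matrix \<open>I - \<gamma> Pstar\<close>; the last term vanishes when \<open>policy y = policy us\<close>.\<close>
lemma utilde_I_minus_Pstar:
  assumes "\<And>s a. y s a > 0"
  shows "utilde y s' - utilde us s' - \<gamma> * (\<Sum>s\<in>UNIV. (utilde y s - utilde us s) * Pstar s s')
    = KT y s' - KT us s'
      - (\<Sum>s\<in>UNIV. utilde y s * (\<Sum>a\<in>UNIV. (policy y s a - policy us s a) * Kmat \<gamma> P a s s'))"
proof -
  let ?M = "\<lambda>s. \<Sum>a\<in>UNIV. policy us s a * Kmat \<gamma> P a s s'"
  have I_minus: "(\<Sum>s\<in>UNIV. c s * ?M s) = c s' - \<gamma> * (\<Sum>s\<in>UNIV. c s * Pstar s s')" for c :: "'s \<Rightarrow> real"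
  proof -
    have "(\<Sum>s\<in>UNIV. c s * ?M s) = (\<Sum>s\<in>UNIV. (if s = s' then c s else 0) - \<gamma> * (c s * Pstar s s'))"
      unfolding sum_policy_us_Kmat by (intro sum.cong refl) (simp add: algebra_simps)
    then show ?thesis
      by (simp add: sum_subtractf sum_distrib_left)
  qed
  have "KT y s' = (\<Sum>s\<in>UNIV. utilde y s * ?M s)
      + (\<Sum>s\<in>UNIV. utilde y s * (\<Sum>a\<in>UNIV. (policy y s a - policy us s a) * Kmat \<gamma> P a s s'))"
    unfolding KT_eq_sum_policy[OF assms] sum.distrib[symmetric] distrib_left[symmetric]
    by (simp add: left_diff_distrib sum_subtractf)
  moreover have "KT us s' = (\<Sum>s\<in>UNIV. utilde us s * ?M s)"
    by (rule KT_eq_sum_policy[OF us_pos])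
  moreover have "(\<Sum>s\<in>UNIV. (utilde y s - utilde us s) * ?M s)
      = (\<Sum>s\<in>UNIV. utilde y s * ?M s) - (\<Sum>s\<in>UNIV. utilde us s * ?M s)"
    by (simp add: left_diff_distrib sum_subtractf)
  ultimately show ?thesis
    using I_minus[of "\<lambda>s. utilde y s - utilde us s"] by linarith
qed

lemma lyapunov_le_of_close:
  assumes x: "\<And>s. \<bar>x s - vs s\<bar> \<le> \<delta>" and y: "\<And>s a. \<bar>y s a - us s a\<bar> \<le> \<delta>"
    and small: "\<And>s a. \<delta> \<le> us s a / 2"
  shows "lyapunov x y \<le> \<delta>\<^sup>2 * (\<alpha> / 2 * real CARD('s) + \<tau> * (\<Sum>s\<in>UNIV. \<Sum>a\<in>UNIV. 2 / us s a))"
proof -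
  have sq: "z\<^sup>2 \<le> \<delta>\<^sup>2" if "\<bar>z\<bar> \<le> \<delta>" for z :: real
    using that abs_le_square_iff[of z \<delta>] by (simp add: abs_le_iff)
  have "kl_div (us s a) (y s a) \<le> \<delta>\<^sup>2 * (2 / us s a)" for s a
  proof -
    have "us s a / 2 \<le> y s a"
      using y[of s a] small[of s a] by (simp add: abs_le_iff)
    moreover have "0 < us s a" by (rule us_pos)
    ultimately have "kl_div (us s a) (y s a) \<le> (y s a - us s a)\<^sup>2 / y s a"
      by (intro kl_div_le_chi_squared) auto
    also have "\<dots> \<le> \<delta>\<^sup>2 / (us s a / 2)"
      using sq[OF y] \<open>us s a / 2 \<le> y s a\<close> \<open>0 < us s a\<close> by (intro frac_le) auto
    finally show ?thesis
      by simp
  qed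
  then have "(\<Sum>s\<in>UNIV. \<Sum>a\<in>UNIV. kl_div (us s a) (y s a)) \<le> \<delta>\<^sup>2 * (\<Sum>s\<in>UNIV. \<Sum>a\<in>UNIV. 2 / us s a)"
    by (simp add: sum_distrib_left sum_mono)
  then have "\<tau> * (\<Sum>s\<in>UNIV. \<Sum>a\<in>UNIV. kl_div (us s a) (y s a))
      \<le> \<tau> * (\<delta>\<^sup>2 * (\<Sum>s\<in>UNIV. \<Sum>a\<in>UNIV. 2 / us s a))"
    using tau by (intro mult_left_mono) auto
  moreover have "(\<Sum>s\<in>UNIV. (x s - vs s)\<^sup>2) \<le> (\<Sum>s\<in>(UNIV::'s set). \<delta>\<^sup>2)"
    using sq[OF x] by (intro sum_mono)
  then have "\<alpha> / 2 * (\<Sum>s\<in>UNIV. (x s - vs s)\<^sup>2) \<le> \<alpha> / 2 * (\<delta>\<^sup>2 * real CARD('s))"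
    using alpha by (intro mult_left_mono) (auto simp: mult.commute)
  ultimately show ?thesis
    unfolding lyapunov_def by (simp add: algebra_simps)
qed

definition dist_bound :: "real \<Rightarrow> real" where
  "dist_bound \<eta> = real CARD('s) * sqrt (2 * \<eta> / \<alpha>)
     + (\<Sum>s\<in>UNIV. \<Sum>a\<in>UNIV. sqrt (\<eta> / \<tau>) * (2 * sqrt (us s a) + sqrt (\<eta> / \<tau>)))"

lemma dist_bound_tendsto: "(dist_bound \<longlongrightarrow> 0) (at_right 0)"
proof -
  have "(dist_bound \<longlongrightarrow> dist_bound 0) (at_right 0)"
    unfolding dist_bound_def[abs_def] using alpha tau by (intro tendsto_intros) auto
  then show ?thesis
    by (simp add: dist_bound_def)
qed

end

section \<open>Solutions of the dynamics\<close>

locale mdp_trajectory = saddle_mdp P r \<gamma> \<tau> \<alpha> vs us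
  for P :: "'a::finite \<Rightarrow> 's::finite \<Rightarrow> 's \<Rightarrow> real" and r \<gamma> \<tau> \<alpha> vs us +
  fixes v :: "real \<Rightarrow> 's \<Rightarrow> real" and u :: "real \<Rightarrow> 's \<Rightarrow> 'a \<Rightarrow> real"
  assumes solution: "is_solution \<alpha> \<tau> \<gamma> P r v u"
begin

lemma u_pos: "t \<ge> 0 \<Longrightarrow> u t s a > 0"
  using solution by (auto simp: is_solution_def)

lemma v_has_derivative:
  "t \<ge> 0 \<Longrightarrow> ((\<lambda>t. v t s) has_real_derivative vfield_v (v t) (u t) s) (at t within {0..})"
  using solution by (auto simp: is_solution_def vfield_v_def)

lemma u_has_derivative:
  "t \<ge> 0 \<Longrightarrow> ((\<lambda>t. u t s a) has_real_derivative vfield_u (v t) (u t) s a) (at t within {0..})"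
  using solution by (auto simp: is_solution_def vfield_u_def)

definition L :: "real \<Rightarrow> real" where
  "L t = lyapunov (v t) (u t)"

lemma L_has_derivative:
  assumes "t \<ge> 0"
  shows "(L has_real_derivative lyapunov_deriv (v t) (u t)) (at t within {0..})"
proof -
  have "((\<lambda>t. (v t s - vs s) * (v t s - vs s)) has_real_derivative
      (vfield_v (v t) (u t) s - 0) * (v t s - vs s) + (vfield_v (v t) (u t) s - 0) * (v t s - vs s))
      (at t within {0..})" for s
    using assms by (intro DERIV_mult DERIV_diff v_has_derivative DERIV_const)
  then have "((\<lambda>t. (v t s - vs s)\<^sup>2) has_real_derivative 2 * ((v t s - vs s) * vfield_v (v t) (u t) s))
      (at t within {0..})" for s
    by (simp add: power2_eq_square algebra_simps)
  then have "(L has_real_derivative \<alpha> / 2 * (\<Sum>s\<in>UNIV. 2 * ((v t s - vs s) * vfield_v (v t) (u t) s))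
      + \<tau> * (\<Sum>s\<in>UNIV. \<Sum>a\<in>UNIV. (1 - us s a / u t s a) * vfield_u (v t) (u t) s a)) (at t within {0..})"
    unfolding L_def[abs_def] lyapunov_def using assms
    by (intro DERIV_add DERIV_cmult DERIV_sum kl_div_has_real_derivative u_has_derivative u_pos)
  then show ?thesis
    by (simp add: lyapunov_deriv_def sum_distrib_left[symmetric])
qed

lemma lyapunov_deriv_bound:
  assumes "t \<ge> 0"
  shows "\<alpha> * (\<Sum>s\<in>UNIV. (v t s - vs s)\<^sup>2) + \<tau> * hellinger (u t) \<le> - lyapunov_deriv (v t) (u t)"
  using lyapunov_deriv_le[where x = "v t" and y = "u t"] u_pos[OF assms] by simp

lemma lyapunov_deriv_nonpos:
  assumes "t \<ge> 0"
  shows "lyapunov_deriv (v t) (u t) \<le> 0"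
proof -
  have "0 \<le> \<alpha> * (\<Sum>s\<in>UNIV. (v t s - vs s)\<^sup>2)" "0 \<le> \<tau> * hellinger (u t)"
    using alpha tau hellinger_nonneg by (simp_all add: sum_nonneg)
  then show ?thesis
    using lyapunov_deriv_bound[OF assms] by linarith
qed

lemma L_decreasing: "0 \<le> a \<Longrightarrow> a \<le> b \<Longrightarrow> L b \<le> L a"
  using DERIV_nonpos_imp_decreasing_on_nonneg[OF L_has_derivative lyapunov_deriv_nonpos] .

lemma L_nonneg: "t \<ge> 0 \<Longrightarrow> 0 \<le> L t"
  unfolding L_def using lyapunov_nonneg u_pos by simp

lemma L_convergent: obtains l where "(L \<longlongrightarrow> l) at_top"
  by (rule decreasing_bounded_below_convergent_at_top[OF L_decreasing L_nonneg])

lemma v_near_vs: "t \<ge> 0 \<Longrightarrow> \<bar>v t s - vs s\<bar> \<le> sqrt (2 * L 0 / \<alpha>)"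
proof -
  assume "t \<ge> 0"
  have "\<alpha> / 2 * (v t s - vs s)\<^sup>2 \<le> L t"
    unfolding L_def by (rule lyapunov_ge_v) (rule u_pos[OF \<open>t \<ge> 0\<close>])
  also have "L t \<le> L 0"
    using L_decreasing \<open>t \<ge> 0\<close> by simp
  finally have "(v t s - vs s)\<^sup>2 \<le> 2 * L 0 / \<alpha>"
    using alpha by (simp add: field_simps)
  then show ?thesis
    using real_sqrt_le_mono by fastforce
qed

lemma kl_div_u_le: "t \<ge> 0 \<Longrightarrow> kl_div (us s a) (u t s a) \<le> L 0 / \<tau>"
proof -
  assume "t \<ge> 0"
  have "\<tau> * kl_div (us s a) (u t s a) \<le> L t"
    unfolding L_def by (rule lyapunov_ge_kl_div) (rule u_pos[OF \<open>t \<ge> 0\<close>])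
  also have "L t \<le> L 0"
    using L_decreasing \<open>t \<ge> 0\<close> by simp
  finally show ?thesis
    using tau by (simp add: field_simps)
qed

lemma u_lower_bound: obtains lo where "lo > 0" "\<And>t. t \<ge> 0 \<Longrightarrow> lo \<le> u t s a"
proof
  show "us s a * exp (- ((L 0 / \<tau> + us s a) / us s a)) > 0"
    using us_pos by simp
qed (rule kl_div_bounded_imp_lower_bound[OF us_pos u_pos kl_div_u_le])

lemma utilde_lower_bound: obtains lo where "lo > 0" "\<And>t. t \<ge> 0 \<Longrightarrow> lo \<le> utilde (u t) s"
proof -
  fix a :: 'a
  obtain lo where lo: "lo > 0" "\<And>t. t \<ge> 0 \<Longrightarrow> lo \<le> u t s a"
    by (rule u_lower_bound[where s = s and a = a]) blast
  have le: "u t s a \<le> utilde (u t) s" if "t \<ge> 0" for t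
    unfolding utilde_def using u_pos that by (intro member_le_sum) (auto simp: less_imp_le)
  have "lo \<le> utilde (u t) s" if "t \<ge> 0" for t
    using lo(2)[OF that] le[OF that] by (rule order_trans)
  with lo(1) show ?thesis
    by (rule that)
qed

lemma bounded_v: "bounded ((\<lambda>t. v t s) ` {0..})"
proof -
  have "\<bar>v t s\<bar> \<le> \<bar>vs s\<bar> + sqrt (2 * L 0 / \<alpha>)" if "t \<ge> 0" for t
    using v_near_vs[OF that, of s] by linarith
  then show ?thesis
    unfolding bounded_iff by auto
qed

lemma bounded_u: "bounded ((\<lambda>t. u t s a) ` {0..})"
proof -
  have "\<bar>u t s a\<bar> \<le> us s a + sqrt (L 0 / \<tau>) * (2 * sqrt (us s a) + sqrt (L 0 / \<tau>))" if "t \<ge> 0" for t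
    using kl_div_bounded_imp_near[OF us_pos[of s a] u_pos[OF that] kl_div_u_le[OF that]] u_pos[OF that, of s a]
    by linarith
  then show ?thesis
    unfolding bounded_iff by auto
qed

lemma bounded_utilde: "bounded ((\<lambda>t. utilde (u t) s) ` {0..})"
  unfolding utilde_def by (intro bounded_sum_comp bounded_u) auto

lemma bounded_vfield_v: "bounded ((\<lambda>t. vfield_v (v t) (u t) s) ` {0..})"
  unfolding vfield_v_def
  by (intro bounded_minus_comp bounded_mult_comp bounded_sum_comp bounded_const_comp bounded_u bounded_v
      iffD2[OF uminus_bounded_comp]) auto

lemma bounded_vfield_u: "bounded ((\<lambda>t. vfield_u (v t) (u t) s a) ` {0..})"
proof -
  obtain lo where "lo > 0" "\<And>t. t \<ge> 0 \<Longrightarrow> lo \<le> u t s a"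
    by (rule u_lower_bound[where s = s and a = a]) blast
  then have "bounded ((\<lambda>t. ln (u t s a)) ` {0..})"
    by (intro bounded_ln_comp bounded_u) auto
  obtain lo' where "lo' > 0" "\<And>t. t \<ge> 0 \<Longrightarrow> lo' \<le> utilde (u t) s"
    by (rule utilde_lower_bound[where s = s]) blast
  then have "bounded ((\<lambda>t. ln (utilde (u t) s)) ` {0..})"
    by (intro bounded_ln_comp bounded_utilde) auto
  then have "bounded ((\<lambda>t. ln (u t s a) - ln (utilde (u t) s)) ` {0..})"
    using \<open>bounded ((\<lambda>t. ln (u t s a)) ` {0..})\<close> by (intro bounded_minus_comp)
  moreover have "(\<lambda>t. ln (u t s a / utilde (u t) s)) ` {0..} = (\<lambda>t. ln (u t s a) - ln (utilde (u t) s)) ` {0..}"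
    using u_pos utilde_pos[of "u _" s, OF u_pos] by (intro image_cong) (auto simp: ln_div less_imp_neq[symmetric])
  ultimately have "bounded ((\<lambda>t. ln (u t s a / utilde (u t) s)) ` {0..})"
    by simp
  then show ?thesis
    unfolding vfield_u_def
    by (intro bounded_mult_comp bounded_minus_comp bounded_sum_comp bounded_const_comp bounded_u bounded_v
        iffD2[OF uminus_bounded_comp]) auto
qed

lemma lipschitz_v: obtains B where "B-lipschitz_on {0..} (\<lambda>t. v t s)"
  by (rule bounded_DERIV_imp_lipschitz_on_nonneg[OF v_has_derivative bounded_vfield_v])

lemma lipschitz_u: obtains B where "B-lipschitz_on {0..} (\<lambda>t. u t s a)"
  by (rule bounded_DERIV_imp_lipschitz_on_nonneg[OF u_has_derivative bounded_vfield_u])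

lemma lipschitz_utilde: obtains B where "B-lipschitz_on {0..} (\<lambda>t. utilde (u t) s)"
proof -
  have "((\<lambda>t. utilde (u t) s) has_real_derivative (\<Sum>a\<in>UNIV. vfield_u (v t) (u t) s a)) (at t within {0..})"
    if "t \<ge> 0" for t
    unfolding utilde_def using that by (intro DERIV_sum u_has_derivative)
  moreover have "bounded ((\<lambda>t. \<Sum>a\<in>UNIV. vfield_u (v t) (u t) s a) ` {0..})"
    by (intro bounded_sum_comp bounded_vfield_u) auto
  ultimately show ?thesis
    by (rule bounded_DERIV_imp_lipschitz_on_nonneg) (auto intro: that)
qed

lemma uniformly_continuous_v: "uniformly_continuous_on {0..} (\<lambda>t. v t s)"
  by (rule lipschitz_v) (rule lipschitz_on_uniformly_continuous)

lemma uniformly_continuous_u: "uniformly_continuous_on {0..} (\<lambda>t. u t s a)"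
  by (rule lipschitz_u) (rule lipschitz_on_uniformly_continuous)

lemma policy_u_pos: "t \<ge> 0 \<Longrightarrow> policy (u t) s a > 0"
  by (rule policy_pos) (rule u_pos)

lemma barbalat_lyapunov:
  assumes "uniformly_continuous_on {0..} \<phi>"
    and "\<And>t. t \<ge> 0 \<Longrightarrow> 0 \<le> \<phi> t" "\<And>t. t \<ge> 0 \<Longrightarrow> \<phi> t \<le> - lyapunov_deriv (v t) (u t)"
  shows "(\<phi> \<longlongrightarrow> 0) at_top"
proof -
  obtain l where "(L \<longlongrightarrow> l) at_top"
    by (rule L_convergent)
  then show ?thesis
    using assms by (intro barbalat_nonneg[OF tendsto_minus]) (auto intro: DERIV_minus L_has_derivative)
qed

lemma v_tendsto: "((\<lambda>t. v t s) \<longlongrightarrow> vs s) at_top"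
proof -
  define R where "R = sqrt (2 * L 0 / \<alpha>)"
  have "v t s \<in> {vs s - R .. vs s + R}" if "t \<ge> 0" for t
    using v_near_vs[OF that, of s] unfolding R_def by (simp add: abs_le_iff)
  then have "(\<lambda>t. v t s) ` {0..} \<subseteq> {vs s - R .. vs s + R}"
    by auto
  then have uc: "uniformly_continuous_on {0..} (\<lambda>t. \<alpha> * (v t s - vs s)\<^sup>2)"
    by (rule uniformly_continuous_on_compose_compact[OF uniformly_continuous_v _ compact_Icc,
          where g = "\<lambda>z. \<alpha> * (z - vs s)\<^sup>2"]) (intro continuous_intros)
  have nonneg: "0 \<le> \<alpha> * (v t s - vs s)\<^sup>2" for t
    using alpha by simp
  have le: "\<alpha> * (v t s - vs s)\<^sup>2 \<le> - lyapunov_deriv (v t) (u t)" if "t \<ge> 0" for t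
  proof -
    have "\<alpha> * (v t s - vs s)\<^sup>2 \<le> \<alpha> * (\<Sum>s\<in>UNIV. (v t s - vs s)\<^sup>2)"
      using alpha by (intro mult_left_mono member_le_sum) auto
    moreover have "0 \<le> \<tau> * hellinger (u t)"
      using tau hellinger_nonneg by simp
    ultimately show ?thesis
      using lyapunov_deriv_bound[OF that] by linarith
  qed
  have "((\<lambda>t. \<alpha> * (v t s - vs s)\<^sup>2) \<longlongrightarrow> \<alpha> * 0) at_top"
    using barbalat_lyapunov[OF uc nonneg le] by simp
  then have "((\<lambda>t. (v t s - vs s)\<^sup>2) \<longlongrightarrow> 0) at_top"
    by (rule tendsto_mult_left_iff[THEN iffD1, rotated]) (use alpha in simp)
  then have "((\<lambda>t. v t s - vs s) \<longlongrightarrow> 0) at_top"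
    by (rule tendsto_zero_of_square)
  then show ?thesis
    by (rule LIM_zero_cancel)
qed

lemma uniformly_continuous_sqrt_policy_gap:
  "uniformly_continuous_on {0..} (\<lambda>t. (sqrt (policy us s a) - sqrt (policy (u t) s a))\<^sup>2)"
proof -
  define g where "g z = (sqrt (policy us s a) - sqrt (fst z / snd z))\<^sup>2" for z :: "real \<times> real"
  obtain lo where lo: "\<And>t. t \<ge> 0 \<Longrightarrow> lo \<le> u t s a"
    by (rule u_lower_bound[where s = s and a = a]) blast
  obtain lo' where "lo' > 0" and lo': "\<And>t. t \<ge> 0 \<Longrightarrow> lo' \<le> utilde (u t) s"
    by (rule utilde_lower_bound[where s = s]) blast
  obtain hi where hi: "\<And>t. t \<ge> 0 \<Longrightarrow> \<bar>u t s a\<bar> \<le> hi"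
    using bounded_u[of s a] by (auto simp: bounded_iff)
  obtain hi' where hi': "\<And>t. t \<ge> 0 \<Longrightarrow> \<bar>utilde (u t) s\<bar> \<le> hi'"
    using bounded_utilde[of s] by (auto simp: bounded_iff)
  obtain B where B: "B-lipschitz_on {0..} (\<lambda>t. u t s a)"
    by (rule lipschitz_u)
  obtain B' where B': "B'-lipschitz_on {0..} (\<lambda>t. utilde (u t) s)"
    by (rule lipschitz_utilde)
  have "uniformly_continuous_on {0..} (\<lambda>t. (u t s a, utilde (u t) s))"
    by (rule lipschitz_on_uniformly_continuous[OF lipschitz_on_Pair[OF B B']])
  moreover have "(u t s a, utilde (u t) s) \<in> {lo..hi} \<times> {lo'..hi'}" if "t \<ge> 0" for t
    using lo[OF that] lo'[OF that] hi[OF that] hi'[OF that] by (simp add: abs_le_iff)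
  then have "(\<lambda>t. (u t s a, utilde (u t) s)) ` {0..} \<subseteq> {lo..hi} \<times> {lo'..hi'}"
    by auto
  moreover have "continuous_on ({lo..hi} \<times> {lo'..hi'}) g"
    unfolding g_def using \<open>lo' > 0\<close> by (intro continuous_intros) auto
  ultimately have "uniformly_continuous_on {0..} (\<lambda>t. g (u t s a, utilde (u t) s))"
    by (rule uniformly_continuous_on_compose_compact[OF _ _ compact_Times[OF compact_Icc compact_Icc]])
  then show ?thesis
    by (simp add: g_def policy_def)
qed

lemma policy_tendsto: "((\<lambda>t. policy (u t) s a) \<longlongrightarrow> policy us s a) at_top"
proof -
  define c where "c = \<tau> * utilde us s"
  have "c > 0"
    using tau utilde_us_pos[of s] by (simp add: c_def)
  have le: "c * (sqrt (policy us s a) - sqrt (policy (u t) s a))\<^sup>2 \<le> - lyapunov_deriv (v t) (u t)"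
    if "t \<ge> 0" for t
  proof -
    have "c * (sqrt (policy us s a) - sqrt (policy (u t) s a))\<^sup>2 \<le> \<tau> * hellinger (u t)"
      unfolding c_def mult.assoc using hellinger_ge tau by (intro mult_left_mono) auto
    moreover have "0 \<le> \<alpha> * (\<Sum>s\<in>UNIV. (v t s - vs s)\<^sup>2)"
      using alpha by (simp add: sum_nonneg)
    ultimately show ?thesis
      using lyapunov_deriv_bound[OF that] by linarith
  qed
  have "((\<lambda>t. c * (sqrt (policy us s a) - sqrt (policy (u t) s a))\<^sup>2) \<longlongrightarrow> c * 0) at_top"
    using \<open>c > 0\<close>
    by (simp add: barbalat_lyapunov[OF uniformly_continuous_on_cmul_left[OF uniformly_continuous_sqrt_policy_gap] _ le])
  then have "((\<lambda>t. (sqrt (policy us s a) - sqrt (policy (u t) s a))\<^sup>2) \<longlongrightarrow> 0) at_top"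
    by (rule tendsto_mult_left_iff[THEN iffD1, rotated]) (use \<open>c > 0\<close> in simp)
  from tendsto_zero_of_square[OF this]
  have "((\<lambda>t. sqrt (policy us s a) - (sqrt (policy us s a) - sqrt (policy (u t) s a)))
      \<longlongrightarrow> sqrt (policy us s a) - 0) at_top"
    by (intro tendsto_diff tendsto_const)
  then have "((\<lambda>t. (sqrt (policy (u t) s a))\<^sup>2) \<longlongrightarrow> (sqrt (policy us s a))\<^sup>2) at_top"
    by (intro tendsto_power) simp
  then have "((\<lambda>t. (sqrt (policy (u t) s a))\<^sup>2) \<longlongrightarrow> policy us s a) at_top"
    using policy_us_pos[of s a] by simp
  moreover have "\<forall>\<^sub>F t in at_top. (sqrt (policy (u t) s a))\<^sup>2 = policy (u t) s a"
    using eventually_ge_at_top[of 0]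
    by eventually_elim (simp add: less_imp_le policy_u_pos)
  ultimately show ?thesis
    by (rule Lim_transform_eventually)
qed

lemma vfield_v_tendsto: "((\<lambda>t. vfield_v (v t) (u t) s) \<longlongrightarrow> 0) at_top"
proof (rule barbalat[OF v_tendsto v_has_derivative])
  show "uniformly_continuous_on {0..} (\<lambda>t. vfield_v (v t) (u t) s)"
    unfolding vfield_v_def
    by (intro uniformly_continuous_on_minus uniformly_continuous_on_diff uniformly_continuous_on_cmul_left
        uniformly_continuous_on_sum uniformly_continuous_v uniformly_continuous_u)
qed

lemma KT_tendsto: "((\<lambda>t. KT (u t) s) \<longlongrightarrow> KT us s) at_top"
proof -
  have "KT (u t) s = \<alpha> * (vfield_v (v t) (u t) s + v t s)" for t
    using alpha by (simp add: vfield_v_def KT_def field_simps)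
  moreover have "((\<lambda>t. \<alpha> * (vfield_v (v t) (u t) s + v t s)) \<longlongrightarrow> \<alpha> * (0 + vs s)) at_top"
    by (intro tendsto_intros vfield_v_tendsto v_tendsto)
  ultimately show ?thesis
    using alpha_vs_eq_KT[of s] by simp
qed

lemma utilde_tendsto: "((\<lambda>t. utilde (u t) s) \<longlongrightarrow> utilde us s) at_top"
proof -
  let ?D = "\<lambda>t s s'. \<Sum>a\<in>UNIV. (policy (u t) s a - policy us s a) * Kmat \<gamma> P a s s'"
  have "((\<lambda>t. KT (u t) s' - KT us s' - (\<Sum>s\<in>UNIV. utilde (u t) s * ?D t s s')) \<longlongrightarrow> 0) at_top" for s'
  proof -
    have "((\<lambda>t. utilde (u t) s * ?D t s s') \<longlongrightarrow> 0) at_top" for s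
    proof (rule bounded_mult_tendsto_zero[OF bounded_utilde])
      have "((\<lambda>t. ?D t s s') \<longlongrightarrow> (\<Sum>a\<in>UNIV. (policy us s a - policy us s a) * Kmat \<gamma> P a s s')) at_top"
        by (intro tendsto_sum tendsto_mult tendsto_diff policy_tendsto tendsto_const)
      then show "((\<lambda>t. ?D t s s') \<longlongrightarrow> 0) at_top"
        by simp
    qed
    then have "((\<lambda>t. KT (u t) s' - KT us s' - (\<Sum>s\<in>UNIV. utilde (u t) s * ?D t s s'))
        \<longlongrightarrow> KT us s' - KT us s' - (\<Sum>s\<in>(UNIV::'s set). 0)) at_top"
      by (intro tendsto_diff tendsto_sum KT_tendsto tendsto_const)
    then show ?thesis
      by simp
  qed
  moreover have "\<forall>\<^sub>F t in at_top. KT (u t) s' - KT us s' - (\<Sum>s\<in>UNIV. utilde (u t) s * ?D t s s')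
      = utilde (u t) s' - utilde us s' - \<gamma> * (\<Sum>s\<in>UNIV. (utilde (u t) s - utilde us s) * Pstar s s')" for s'
    using eventually_ge_at_top[of 0]
    by eventually_elim (auto intro!: utilde_I_minus_Pstar[symmetric] u_pos)
  ultimately have "((\<lambda>t. utilde (u t) s' - utilde us s' - \<gamma> * (\<Sum>s\<in>UNIV. (utilde (u t) s - utilde us s) * Pstar s s'))
      \<longlongrightarrow> 0) at_top" for s'
    by (rule Lim_transform_eventually)
  then have "((\<lambda>t. utilde (u t) s - utilde us s) \<longlongrightarrow> 0) at_top"
    using gamma by (intro tendsto_zero_I_minus_stochastic[where Q = Pstar and e = "\<lambda>t s. utilde (u t) s - utilde us s",
        OF Pstar_nonneg Pstar_sum]) auto
  then show ?thesis
    by (rule LIM_zero_cancel)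
qed

lemma u_tendsto: "((\<lambda>t. u t s a) \<longlongrightarrow> us s a) at_top"
proof -
  have "((\<lambda>t. utilde (u t) s * policy (u t) s a) \<longlongrightarrow> utilde us s * policy us s a) at_top"
    by (intro tendsto_mult utilde_tendsto policy_tendsto)
  moreover have "\<forall>\<^sub>F t in at_top. utilde (u t) s * policy (u t) s a = u t s a"
    using eventually_ge_at_top[of 0] by eventually_elim (auto intro!: utilde_mult_policy u_pos)
  ultimately have "((\<lambda>t. u t s a) \<longlongrightarrow> utilde us s * policy us s a) at_top"
    by (rule Lim_transform_eventually)
  then show ?thesis
    using utilde_mult_policy[of us s a, OF us_pos] by simp
qed

lemma state_dist_le_dist_bound:
  assumes "t \<ge> 0" "L 0 \<le> \<eta>"
  shows "state_dist (v t) (u t) vs us \<le> dist_bound \<eta>"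
proof -
  have "\<bar>v t s - vs s\<bar> \<le> sqrt (2 * \<eta> / \<alpha>)" for s
    using v_near_vs[OF assms(1), of s] assms(2) alpha
    by (meson order_trans real_sqrt_le_mono divide_right_mono mult_left_mono less_imp_le zero_le_numeral)
  moreover have "\<bar>u t s a - us s a\<bar> \<le> sqrt (\<eta> / \<tau>) * (2 * sqrt (us s a) + sqrt (\<eta> / \<tau>))" for s a
  proof (rule kl_div_bounded_imp_near[OF us_pos u_pos[OF assms(1)]])
    show "kl_div (us s a) (u t s a) \<le> \<eta> / \<tau>"
      using kl_div_u_le[OF assms(1), of s a] assms(2) tau by (meson order_trans divide_right_mono less_imp_le)
  qed
  ultimately show ?thesis
    unfolding state_dist_def dist_bound_def
    by (intro add_mono order_trans[OF sum_mono sum_constant[THEN eq_refl]] sum_mono) auto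
qed

end

lemma abs_le_state_dist_v: "\<bar>x s - x' s\<bar> \<le> state_dist x y x' y'"
proof -
  have "\<bar>x s - x' s\<bar> \<le> (\<Sum>s\<in>UNIV. \<bar>x s - x' s\<bar>)"
    by (rule member_le_sum) auto
  then show ?thesis
    unfolding state_dist_def by (smt (verit) sum_nonneg abs_ge_zero)
qed

lemma abs_le_state_dist_u: "\<bar>y s a - y' s a\<bar> \<le> state_dist x y x' y'"
proof -
  have "\<bar>y s a - y' s a\<bar> \<le> (\<Sum>s\<in>UNIV. \<Sum>a\<in>UNIV. \<bar>y s a - y' s a\<bar>)"
    by (intro order_trans[OF _ member_le_sum[of s]] member_le_sum sum_nonneg) auto
  then show ?thesis
    unfolding state_dist_def by (smt (verit) sum_nonneg abs_ge_zero)
qed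

context saddle_mdp
begin

lemma mdp_trajectoryI:
  assumes "is_solution \<alpha> \<tau> \<gamma> P r v u"
  shows "mdp_trajectory P r \<gamma> \<tau> \<alpha> vs us v u"
  by (intro mdp_trajectory.intro saddle_mdp_axioms mdp_trajectory_axioms.intro assms)

lemma saddle_lyapunov_stable:
  assumes "\<epsilon> > 0"
  shows "\<exists>\<delta>>0. \<forall>v u. is_solution \<alpha> \<tau> \<gamma> P r v u \<longrightarrow> state_dist (v 0) (u 0) vs us < \<delta> \<longrightarrow>
           (\<forall>t\<ge>0. state_dist (v t) (u t) vs us < \<epsilon>)"
proof -
  define C where "C = \<alpha> / 2 * real CARD('s) + \<tau> * (\<Sum>s\<in>UNIV. \<Sum>a\<in>UNIV. 2 / us s a)"
  have "\<forall>\<^sub>F \<eta> in at_right 0. 0 < \<eta> \<and> dist_bound \<eta> < \<epsilon>"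
    by (intro eventually_conj eventually_at_right_less order_tendstoD(2)[OF dist_bound_tendsto assms])
  then obtain \<eta> where "0 < \<eta>" and \<eta>: "dist_bound \<eta> < \<epsilon>"
    using eventually_happens trivial_limit_at_right_real by blast
  have "((\<lambda>\<delta>. \<delta>\<^sup>2 * C) \<longlongrightarrow> 0\<^sup>2 * C) (at_right 0)"
    by (intro tendsto_intros)
  then have "\<forall>\<^sub>F \<delta> in at_right 0. \<delta>\<^sup>2 * C < \<eta>"
    using \<open>0 < \<eta>\<close> by (intro order_tendstoD(2)) auto
  moreover have "\<forall>\<^sub>F \<delta> in at_right 0. \<forall>s a. \<delta> < us s a / 2"
    using us_pos by (intro eventually_all_finite order_tendstoD(2)[OF tendsto_ident_at]) simp
  ultimately have "\<forall>\<^sub>F \<delta> in at_right 0. 0 < \<delta> \<and> \<delta>\<^sup>2 * C < \<eta> \<and> (\<forall>s a. \<delta> < us s a / 2)"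
    by (intro eventually_conj eventually_at_right_less)
  then obtain \<delta> where "0 < \<delta>" and \<delta>: "\<delta>\<^sup>2 * C < \<eta>" "\<And>s a. \<delta> < us s a / 2"
    using eventually_happens trivial_limit_at_right_real by blast
  have "\<forall>t\<ge>0. state_dist (v t) (u t) vs us < \<epsilon>"
    if "is_solution \<alpha> \<tau> \<gamma> P r v u" "state_dist (v 0) (u 0) vs us < \<delta>" for v u
  proof -
    interpret mdp_trajectory P r \<gamma> \<tau> \<alpha> vs us v u
      by (rule mdp_trajectoryI[OF that(1)])
    have "L 0 \<le> \<delta>\<^sup>2 * C"
      unfolding L_def C_def using that(2) \<delta>(2)
      by (intro lyapunov_le_of_close less_imp_le order_trans[OF abs_le_state_dist_v]
          order_trans[OF abs_le_state_dist_u]) auto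
    then show ?thesis
      using state_dist_le_dist_bound \<delta>(1) \<eta> by (smt (verit))
  qed
  then show ?thesis
    using \<open>0 < \<delta>\<close> by blast
qed

lemma solution_tendsto_saddle:
  assumes "is_solution \<alpha> \<tau> \<gamma> P r v u"
  shows "(\<forall>s. ((\<lambda>t. v t s) \<longlongrightarrow> vs s) at_top) \<and> (\<forall>s a. ((\<lambda>t. u t s a) \<longlongrightarrow> us s a) at_top)"
proof -
  interpret mdp_trajectory P r \<gamma> \<tau> \<alpha> vs us v u
    by (rule mdp_trajectoryI[OF assms])
  show ?thesis
    using v_tendsto u_tendsto by blast
qed

end

theorem theorem2p4:
  fixes P :: "'a::finite \<Rightarrow> 's::finite \<Rightarrow> 's \<Rightarrow> real"
    and r :: "'s \<Rightarrow> 'a \<Rightarrow> real"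
    and \<gamma> \<tau> \<alpha> :: real
    and vs :: "'s \<Rightarrow> real" and us :: "'s \<Rightarrow> 'a \<Rightarrow> real"
  assumes P_nonneg: "\<And>a s s'. P a s s' \<ge> 0"
    and P_sum: "\<And>a s. (\<Sum>s'\<in>UNIV. P a s s') = 1"
    and r_nonneg: "\<And>s a. r s a \<ge> 0"
    and gamma: "0 < \<gamma>" "\<gamma> < 1"
    and tau: "0 < \<tau>"
    and alpha: "0 < \<alpha>"
    and saddle: "is_saddle \<alpha> \<tau> \<gamma> P r vs us"
  shows "(\<forall>\<epsilon>>0. \<exists>\<delta>>0. \<forall>v u. is_solution \<alpha> \<tau> \<gamma> P r v u \<longrightarrow>
            state_dist (v 0) (u 0) vs us < \<delta> \<longrightarrow>
            (\<forall>t\<ge>0. state_dist (v t) (u t) vs us < \<epsilon>))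
       \<and> (\<forall>v u. is_solution \<alpha> \<tau> \<gamma> P r v u \<longrightarrow>
            (\<forall>s. ((\<lambda>t. v t s) \<longlongrightarrow> vs s) at_top) \<and>
            (\<forall>s a. ((\<lambda>t. u t s a) \<longlongrightarrow> us s a) at_top))"
proof -
  interpret saddle_mdp P r \<gamma> \<tau> \<alpha> vs us
    using P_nonneg P_sum gamma tau alpha saddle by unfold_locales
  show ?thesis
    using saddle_lyapunov_stable solution_tendsto_saddle by blast
qed

end
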